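(* Let $X$ be a real Banach space. Then (a) $\inf_{x\in S_X} dc(x) = \mathcal{T}^s(X)$; (b) $\inf_{x\in S_X} sdc(x) = \mathcal{T}(X)$.
   Context: $B_X$, $S_X$, $X^*$ denote the closed unit ball, unit sphere and topological dual of $X$. A slice of $B_X$ is a set $S(x^*,\delta)=\{y\in B_X : x^*(y)>1-\delta\}$ with $x^*\in S_{X^*}$ and $\delta>0$. For $x\in B_X$, the Daugavet constant $dc(x)$ is the supremum of all $\alpha\ge 0$ such that for all $\varepsilon,\delta>0$ and all $y^*\in S_{X^*}$ there exists $y\in S(y^*,\delta)$ with $\|y-x\|>\alpha-\varepsilon$. The super Daugavet constant $sdc(x)$ is the supremum of all $\alpha\ge 0$ such that for all $\varepsilon>0$ and every nonempty relatively weakly open subset $V$ of $B_X$ there exists $y\in V$ with $\|y-x\|>\alpha-\varepsilon$. For $x\in S_X$ and $r>0$ put $B(x,r)=\{u\in B_X : \|u-x\|\le r\}$. The Daugavet indices of thickness are: $\mathcal{T}(X)$, the infimum of all $r>0$ for which there exist $x\in S_X$ and a nonempty relatively weakly open subset $W$ of $B_X$ with $W\subseteq B(x,r)$; and $\mathcal{T}^s(X)$, the infimum of all $r>0$ for which there exist $x\in S_X$ and a slice $S$ of $B_X$ with $S\subseteq B(x,r)$. *)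

theory Defs
  imports "HOL-Analysis.Analysis"
begin

text \<open>
  The topological dual of \<open>'a\<close> is the normed space \<open>'a \<Rightarrow>\<^sub>L real\<close> of bounded linear
  functionals, with the operator norm; \<open>cball 0 1\<close> and \<open>sphere 0 1\<close> are the closed unit
  ball and the unit sphere.

  Suprema and infima are taken in \<open>ereal\<close>, so that the infimum over an empty set is
  \<open>\<infinity>\<close>. This only matters for the zero space, whose unit sphere is empty; otherwise
  all four quantities lie in \<open>[0, 2]\<close>.
\<close>

definition slice :: "('a::real_normed_vector \<Rightarrow>\<^sub>L real) \<Rightarrow> real \<Rightarrow> 'a set" where
  "slice f \<delta> = {y \<in> cball 0 1. blinfun_apply f y > 1 - \<delta>}"

definition is_slice :: "'a::real_normed_vector set \<Rightarrow> bool" where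
  "is_slice S \<longleftrightarrow> (\<exists>f \<in> sphere 0 1. \<exists>\<delta>>0. S = slice f \<delta>)"

text \<open>The coarsest topology for which all bounded linear functionals are continuous.\<close>

definition weak_topology :: "'a::real_normed_vector topology" where
  "weak_topology =
     topology_generated_by {blinfun_apply f -` U | (f :: 'a \<Rightarrow>\<^sub>L real) U. open U}"

definition rel_weakly_open :: "'a::real_normed_vector set \<Rightarrow> bool" where
  "rel_weakly_open V \<longleftrightarrow> openin (subtopology weak_topology (cball 0 1)) V"

definition daugavet_const :: "'a::real_normed_vector \<Rightarrow> ereal" where
  "daugavet_const x = Sup {ereal \<alpha> | \<alpha>. \<alpha> \<ge> 0 \<and>
     (\<forall>\<epsilon>>0. \<forall>\<delta>>0. \<forall>f \<in> sphere 0 1. \<exists>y \<in> slice f \<delta>. norm (y - x) > \<alpha> - \<epsilon>)}"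

definition super_daugavet_const :: "'a::real_normed_vector \<Rightarrow> ereal" where
  "super_daugavet_const x = Sup {ereal \<alpha> | \<alpha>. \<alpha> \<ge> 0 \<and>
     (\<forall>\<epsilon>>0. \<forall>V. rel_weakly_open V \<and> V \<noteq> {} \<longrightarrow> (\<exists>y \<in> V. norm (y - x) > \<alpha> - \<epsilon>))}"

definition ball_part :: "'a::real_normed_vector \<Rightarrow> real \<Rightarrow> 'a set" where
  "ball_part x r = {u \<in> cball 0 1. norm (u - x) \<le> r}"

definition thickness :: "'a::real_normed_vector itself \<Rightarrow> ereal" where
  "thickness _ = Inf {ereal r | r. r > 0 \<and>
     (\<exists>(x::'a) \<in> sphere 0 1. \<exists>W. rel_weakly_open W \<and> W \<noteq> {} \<and> W \<subseteq> ball_part x r)}"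

definition slice_thickness :: "'a::real_normed_vector itself \<Rightarrow> ereal" where
  "slice_thickness _ = Inf {ereal r | r. r > 0 \<and>
     (\<exists>(x::'a) \<in> sphere 0 1. \<exists>S. is_slice S \<and> S \<subseteq> ball_part x r)}"

end

theory Submission
  imports Defs
begin

text \<open>
  Both parts only use that slices, respectively nonempty relatively weakly open sets, form a
  family of nonempty subsets of the unit ball. If a member of the family lies in \<open>B(x,r)\<close>, no
  \<open>\<alpha> > r\<close> is admissible for \<open>x\<close>. Conversely, if some \<open>r > 0\<close> is not admissible for \<open>x\<close>, a member
  of the family witnessing this lies in \<open>B(x,r)\<close>.
\<close>

lemma INF_Sup_distance_eq_Inf_thickness:
  fixes \<F> :: "'a::real_normed_vector set set"
  assumes sub: "\<And>V. V \<in> \<F> \<Longrightarrow> V \<subseteq> cball 0 1"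
    and ne: "\<And>V. V \<in> \<F> \<Longrightarrow> V \<noteq> {}"
  shows "(INF x \<in> A. Sup {ereal \<alpha> | \<alpha>. \<alpha> \<ge> 0 \<and>
           (\<forall>\<epsilon>>0. \<forall>V\<in>\<F>. \<exists>y\<in>V. norm (y - x) > \<alpha> - \<epsilon>)}) =
         Inf {ereal r | r. r > 0 \<and> (\<exists>x\<in>A. \<exists>W\<in>\<F>. W \<subseteq> ball_part x r)}"
    (is "(INF x \<in> A. Sup (?D x)) = Inf ?T")
proof (rule antisym)
  show "(INF x \<in> A. Sup (?D x)) \<le> Inf ?T"
  proof (rule Inf_greatest, clarify)
    fix r x W assume x: "x \<in> A" and W: "W \<in> \<F>" "W \<subseteq> ball_part x r"
    have "Sup (?D x) \<le> ereal r"
    proof (rule Sup_least, clarify)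
      fix \<alpha> assume \<alpha>: "\<forall>\<epsilon>>0. \<forall>V\<in>\<F>. \<exists>y\<in>V. norm (y - x) > \<alpha> - \<epsilon>"
      \<comment> \<open>A point of \<open>W\<close> farther than
        \<open>\<alpha> - \<epsilon>\<close> from \<open>x\<close> is also within \<open>r\<close>
        of \<open>x\<close>.\<close>
      have "\<alpha> \<le> r + \<epsilon>" if "\<epsilon> > 0" for \<epsilon>
        using \<alpha> that W by (fastforce simp: ball_part_def)
      then show "ereal \<alpha> \<le> ereal r"
        by (simp add: field_le_epsilon)
    qed
    with x show "(INF x \<in> A. Sup (?D x)) \<le> ereal r"
      by (rule INF_lower2)
  qed
next
  show "Inf ?T \<le> (INF x \<in> A. Sup (?D x))"
  proof (rule INF_greatest, rule ccontr)
    fix x assume x: "x \<in> A" and less: "\<not> Inf ?T \<le> Sup (?D x)"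
    \<comment> \<open>This real \<open>r\<close> plays two roles: a constant too large to be
      admissible for \<open>x\<close>, and a radius too small to belong to
      \<open>?T\<close>.\<close>
    from ereal_dense2[OF not_le_imp_less[OF less]] obtain r where r: "Sup (?D x) < ereal r" "ereal r < Inf ?T"
      by (elim exE conjE)
    \<comment> \<open>Since members of the family are nonempty, 0 is admissible. So the supremum is
      at least 0, which makes \<open>r\<close> positive, as membership in \<open>?T\<close>
      demands.\<close>
    have "\<exists>y\<in>V. norm (y - x) > 0 - \<epsilon>" if "\<epsilon> > 0" "V \<in> \<F>" for \<epsilon> V
    proof -
      from ne[OF that(2)] obtain y where "y \<in> V" by blast
      with that(1) show ?thesis
        by (intro bexI[of _ y]) (simp_all add: less_le_trans[OF _ norm_ge_zero])
    qed
    then have "ereal 0 \<in> ?D x"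
      by (intro CollectI exI[of _ "0::real"]) simp
    then have "ereal 0 \<le> Sup (?D x)" by (rule Sup_upper)
    from le_less_trans[OF this r(1)] have "r > 0" by simp
    have "ereal r \<notin> ?D x"
    proof
      assume "ereal r \<in> ?D x"
      then have "ereal r \<le> Sup (?D x)" by (rule Sup_upper)
      with r(1) show False by (meson leD)
    qed
    \<comment> \<open>As \<open>r\<close> is nonnegative, only the distance condition can fail; the
      resulting bound \<open>r - \<epsilon>\<close> is even stronger than the bound \<open>r\<close>
      needed.\<close>
    with \<open>r > 0\<close> obtain \<epsilon> V where "\<epsilon> > 0" and V: "V \<in> \<F>" "\<forall>y\<in>V. norm (y - x) \<le> r - \<epsilon>"
      by (auto simp: not_less)
    with sub have "V \<subseteq> ball_part x r"
      by (fastforce simp: ball_part_def)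
    with x V(1) \<open>r > 0\<close> have "ereal r \<in> ?T"
      by (intro CollectI exI[of _ r] conjI refl bexI[of _ x] bexI[of _ V])
    then have "Inf ?T \<le> ereal r" by (rule Inf_lower)
    with r(2) show False by (meson leD)
  qed
qed

text \<open>An empty slice would mean that \<open>f\<close> is at most \<open>1 - \<delta>\<close>
  on the whole unit ball, so by homogeneity \<open>norm f \<le> 1 - \<delta> < 1\<close>.\<close>

lemma slice_nonempty:
  fixes f :: "'a::real_normed_vector \<Rightarrow>\<^sub>L real"
  assumes "norm f = 1" "\<delta> > 0"
  shows "slice f \<delta> \<noteq> {}"
proof
  assume "slice f \<delta> = {}"
  then have le: "blinfun_apply f y \<le> 1 - \<delta>" if "norm y \<le> 1" for y
    using that by (force simp: slice_def)
  \<comment> \<open>\<open>norm_blinfun_bound\<close> requires a nonnegative constant.\<close>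
  from le[of 0] have "1 - \<delta> \<ge> 0" by (simp add: blinfun.zero_right)
  have "norm (blinfun_apply f y) \<le> (1 - \<delta>) * norm y" for y
  proof (cases "y = 0")
    case False
    \<comment> \<open>Using the normalised vector and its negative turns the one-sided bound into
      one on the absolute value.\<close>
    then have "blinfun_apply f (y /\<^sub>R norm y) \<le> 1 - \<delta>" "blinfun_apply f (- (y /\<^sub>R norm y)) \<le> 1 - \<delta>"
      by (intro le; simp)+
    with False show ?thesis
      by (simp add: blinfun.scaleR_right blinfun.minus_right abs_le_iff field_simps)
  qed (simp add: blinfun.zero_right)
  with \<open>1 - \<delta> \<ge> 0\<close> have "norm f \<le> 1 - \<delta>" by (rule norm_blinfun_bound)
  with assms show False by simp
qed

lemma rel_weakly_open_subset_cball: "rel_weakly_open V \<Longrightarrow> V \<subseteq> cball 0 1"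
  using openin_subset by (fastforce simp: rel_weakly_open_def)

theorem proposition2p14:
  "(INF x \<in> sphere (0::'a::banach) 1. daugavet_const x) = slice_thickness TYPE('a) \<and>
   (INF x \<in> sphere (0::'a) 1. super_daugavet_const x) = thickness TYPE('a)"
proof
  \<comment> \<open>Read from right to left, this merges the quantifiers over
    \<open>\<delta>\<close> and \<open>f\<close> into one over the family of slices, the form that
    the general lemma expects.\<close>
  have slices: "(\<forall>V\<in>Collect is_slice. P V) \<longleftrightarrow> (\<forall>\<delta>>0. \<forall>f\<in>sphere 0 1. P (slice f \<delta>))"
    for P :: "'a set \<Rightarrow> bool"
    by (auto simp: is_slice_def)
  have "(INF x \<in> sphere (0::'a) 1. daugavet_const x) =
      Inf {ereal r | r. r > 0 \<and> (\<exists>x\<in>sphere (0::'a) 1. \<exists>S\<in>Collect is_slice. S \<subseteq> ball_part x r)}"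
    unfolding daugavet_const_def slices[of "\<lambda>V. \<exists>y\<in>V. norm (y - x) > \<alpha> - \<epsilon>" for x \<alpha> \<epsilon>, symmetric]
  proof (rule INF_Sup_distance_eq_Inf_thickness)
    fix V :: "'a set" assume "V \<in> Collect is_slice"
    then obtain f \<delta> where "norm f = 1" "\<delta> > 0" and V: "V = slice f \<delta>"
      by (auto simp: is_slice_def)
    then show "V \<noteq> {}" by (simp add: slice_nonempty)
    show "V \<subseteq> cball 0 1" by (auto simp: V slice_def)
  qed
  then show "(INF x \<in> sphere (0::'a) 1. daugavet_const x) = slice_thickness TYPE('a)"
    by (simp only: slice_thickness_def Bex_def mem_Collect_eq)
  \<comment> \<open>Nonemptiness becomes part of the family, so that the hypothesis
    \<open>ne\<close> of the general lemma holds by definition.\<close>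
  have open_sets: "(\<forall>V. rel_weakly_open V \<and> V \<noteq> {} \<longrightarrow> P V) \<longleftrightarrow>
      (\<forall>V\<in>{V. rel_weakly_open V \<and> V \<noteq> {}}. P V)" for P :: "'a set \<Rightarrow> bool"
    by blast
  have "(INF x \<in> sphere (0::'a) 1. super_daugavet_const x) =
      Inf {ereal r | r. r > 0 \<and> (\<exists>x\<in>sphere (0::'a) 1.
        \<exists>W\<in>{V. rel_weakly_open V \<and> V \<noteq> {}}. W \<subseteq> ball_part x r)}"
    unfolding super_daugavet_const_def open_sets
    by (rule INF_Sup_distance_eq_Inf_thickness) (simp_all add: rel_weakly_open_subset_cball)
  then show "(INF x \<in> sphere (0::'a) 1. super_daugavet_const x) = thickness TYPE('a)"
    by (simp only: thickness_def Bex_def mem_Collect_eq conj_assoc)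
qed

end
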